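(* Let $n\ge3$ and let $f\in C^2(\mathbb R^{2n+2})$ be invariant under the representation $\mathscr D$ of the dihedral group $D_n$, i.e. $f(\mathscr D(a)z)=f(z)$ for all $a\in D_n$ and $z\in\mathbb R^{2n+2}$. Let $z_0$ be the central $+$ regular $n$-gon configuration (which is fixed by $\mathscr D$). Then the Hessian $D^2f(z_0)$ is block-diagonal with respect to the direct sum decomposition of $\mathbb R^{2n+2}$ into the following subspaces, each of which is mapped into itself by $D^2f(z_0)$: - the one-dimensional spaces $\operatorname{span}\{v_0\}$, $\operatorname{span}\{w_0\}$ and, if $n$ is even, also $\operatorname{span}\{v_{n/2}\}$, $\operatorname{span}\{w_{n/2}\}$ (scalar blocks); - for each integer $l$ with $2\le l<n/2$, the two-dimensional spaces $\operatorname{span}\{v_l,v_l'\}$ and $\operatorname{span}\{w_l',w_l\}$ ($2\times2$ blocks); - for $l=1$, the three-dimensional spaces $\operatorname{span}\{v_1,v_1',e_{2n+1}\}$ and $\operatorname{span}\{w_1',w_1,e_{2n+2}\}$ ($3\times3$ blocks).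
   Context: Let $\theta=2\pi/n$, $q_k=(\cos k\theta,\sin k\theta)$ and $\tau_k=(-\sin k\theta,\cos k\theta)$ for $k=1,\dots,n$, $q_{n+1}=(0,0)$, and $z_0=(q_1,\dots,q_{n+1})\in(\mathbb R^2)^{n+1}=\mathbb R^{2n+2}$. $D_n=\langle r,s\mid r^n=s^2=e,\ s^{-1}rs=r^{-1}\rangle$ acts linearly on $(\mathbb R^2)^{n+1}$ by permuting the bodies and applying the corresponding planar isometry: with vertex indices taken modulo $n$ in $\{1,\dots,n\}$, $R(\theta)$ the rotation of $\mathbb R^2$ by angle $\theta$ and $S=\operatorname{diag}(1,-1)$, the vector $\mathscr D(r)(x_1,\dots,x_{n+1})$ has $k$-th component $R(\theta)x_{k-1}$ ($1\le k\le n$) and $(n+1)$-st component $R(\theta)x_{n+1}$; the vector $\mathscr D(s)(x_1,\dots,x_{n+1})$ has $k$-th component $Sx_{n-k}$ ($1\le k\le n$) and $(n+1)$-st component $Sx_{n+1}$. One has $\mathscr D(a)z_0=z_0$ for all $a\in D_n$. For integers $l\ge0$ define vectors of $(\mathbb R^2)^{n+1}$ whose $(n+1)$-st component is $0$ and whose $k$-th component ($1\le k\le n$) is: $(v_l)_k=\cos(lk\theta)\,q_k$, $(v_l')_k=-\sin(lk\theta)\,\tau_k$, $(w_l)_k=\cos(lk\theta)\,\tau_k$, $(w_l')_k=\sin(lk\theta)\,q_k$. $e_1,\dots,e_{2n+2}$ is the standard basis of $\mathbb R^{2n+2}$. *)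

theory Defs
  imports "HOL-Analysis.Analysis" "HOL-Algebra.Group"
begin

subsection \<open>Configurations of \<open>n + 1\<close> bodies in the plane\<close>

text \<open>
  A configuration is an element of \<open>real^2^'m\<close>, a Euclidean space of dimension
  \<open>2 * CARD('m)\<close>.  The bodies carry the labels \<open>1, \<dots>, n + 1\<close> through a bijection
  \<open>lab :: 'm \<Rightarrow> nat\<close> onto \<open>{1..n + 1}\<close>, which all definitions below take as a parameter.
\<close>

definition config :: "('m::finite \<Rightarrow> nat) \<Rightarrow> (nat \<Rightarrow> real^2) \<Rightarrow> real^2^'m" where
  "config lab F = (\<chi> i. F (lab i))"

definition body :: "('m::finite \<Rightarrow> nat) \<Rightarrow> real^2^'m \<Rightarrow> nat \<Rightarrow> real^2" where
  "body lab x k = x $ inv_into UNIV lab k"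

definition angle :: "nat \<Rightarrow> real" where
  "angle n = 2 * pi / real n"

definition qvec :: "nat \<Rightarrow> nat \<Rightarrow> real^2" where
  "qvec n k = vector [cos (real k * angle n), sin (real k * angle n)]"

definition tauvec :: "nat \<Rightarrow> nat \<Rightarrow> real^2" where
  "tauvec n k = vector [- sin (real k * angle n), cos (real k * angle n)]"

definition on_vertices :: "nat \<Rightarrow> ('m::finite \<Rightarrow> nat) \<Rightarrow> (nat \<Rightarrow> real^2) \<Rightarrow> real^2^'m" where
  "on_vertices n lab F = config lab (\<lambda>k. if k \<le> n then F k else 0)"

definition z0 :: "nat \<Rightarrow> ('m::finite \<Rightarrow> nat) \<Rightarrow> real^2^'m" where
  "z0 n lab = on_vertices n lab (qvec n)"

definition v_vec :: "nat \<Rightarrow> ('m::finite \<Rightarrow> nat) \<Rightarrow> nat \<Rightarrow> real^2^'m" where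
  "v_vec n lab l = on_vertices n lab (\<lambda>k. cos (real (l * k) * angle n) *\<^sub>R qvec n k)"

definition v'_vec :: "nat \<Rightarrow> ('m::finite \<Rightarrow> nat) \<Rightarrow> nat \<Rightarrow> real^2^'m" where
  "v'_vec n lab l = on_vertices n lab (\<lambda>k. - sin (real (l * k) * angle n) *\<^sub>R tauvec n k)"

definition w_vec :: "nat \<Rightarrow> ('m::finite \<Rightarrow> nat) \<Rightarrow> nat \<Rightarrow> real^2^'m" where
  "w_vec n lab l = on_vertices n lab (\<lambda>k. cos (real (l * k) * angle n) *\<^sub>R tauvec n k)"

definition w'_vec :: "nat \<Rightarrow> ('m::finite \<Rightarrow> nat) \<Rightarrow> nat \<Rightarrow> real^2^'m" where
  "w'_vec n lab l = on_vertices n lab (\<lambda>k. sin (real (l * k) * angle n) *\<^sub>R qvec n k)"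

text \<open>The standard basis vectors \<open>e\<^sub>2\<^sub>n\<^sub>+\<^sub>1\<close> (\<open>c = 1\<close>) and \<open>e\<^sub>2\<^sub>n\<^sub>+\<^sub>2\<close> (\<open>c = 2\<close>) of the central body.\<close>

definition e_center :: "nat \<Rightarrow> ('m::finite \<Rightarrow> nat) \<Rightarrow> 2 \<Rightarrow> real^2^'m" where
  "e_center n lab c = axis (inv_into UNIV lab (n + 1)) (axis c 1)"


subsection \<open>The dihedral group and its representation\<close>

text \<open>The pair \<open>(i, b)\<close> stands for the normal form \<open>r\<^sup>i s\<^sup>b\<close> with \<open>0 \<le> i < n\<close>.\<close>

definition dihedral :: "nat \<Rightarrow> (int \<times> bool) monoid" where
  "dihedral n =
     \<lparr>carrier = {0..<int n} \<times> UNIV,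
      mult = (\<lambda>(i, a) (j, b). ((if a then i - j else i + j) mod int n, a \<noteq> b)),
      one = (0, False)\<rparr>"

definition rotation :: "real \<Rightarrow> real^2 \<Rightarrow> real^2" where
  "rotation t x = vector [cos t * x $ 1 - sin t * x $ 2, sin t * x $ 1 + cos t * x $ 2]"

definition reflection :: "real^2 \<Rightarrow> real^2" where
  "reflection x = vector [x $ 1, - x $ 2]"

text \<open>The representative of \<open>j\<close> modulo \<open>n\<close> in \<open>{1..n}\<close>.\<close>

definition vertex :: "nat \<Rightarrow> int \<Rightarrow> nat" where
  "vertex n j = nat ((j - 1) mod int n) + 1"

definition act_r :: "nat \<Rightarrow> ('m::finite \<Rightarrow> nat) \<Rightarrow> real^2^'m \<Rightarrow> real^2^'m" where
  "act_r n lab x = config lab (\<lambda>k. rotation (angle n)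
     (body lab x (if k \<le> n then vertex n (int k - 1) else n + 1)))"

definition act_s :: "nat \<Rightarrow> ('m::finite \<Rightarrow> nat) \<Rightarrow> real^2^'m \<Rightarrow> real^2^'m" where
  "act_s n lab x = config lab (\<lambda>k. reflection
     (body lab x (if k \<le> n then vertex n (int n - int k) else n + 1)))"

definition dihedral_rep ::
    "nat \<Rightarrow> ('m::finite \<Rightarrow> nat) \<Rightarrow> int \<times> bool \<Rightarrow> real^2^'m \<Rightarrow> real^2^'m" where
  "dihedral_rep n lab a x =
     (act_r n lab ^^ nat (fst a)) (if snd a then act_s n lab x else x)"

lemma group_dihedral:
  assumes "n > 0"
  shows "group (dihedral n)"
proof (rule groupI)
  fix x y z
  assume "x \<in> carrier (dihedral n)" "y \<in> carrier (dihedral n)" "z \<in> carrier (dihedral n)"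
  then show "x \<otimes>\<^bsub>dihedral n\<^esub> y \<otimes>\<^bsub>dihedral n\<^esub> z = x \<otimes>\<^bsub>dihedral n\<^esub> (y \<otimes>\<^bsub>dihedral n\<^esub> z)"
    by (cases x; cases y; cases z) (auto simp: dihedral_def mod_simps algebra_simps)
next
  fix x assume "x \<in> carrier (dihedral n)"
  then obtain i a where x: "x = (i, a)" "0 \<le> i" "i < int n"
    by (cases x) (auto simp: dihedral_def)
  show "\<exists>y\<in>carrier (dihedral n). y \<otimes>\<^bsub>dihedral n\<^esub> x = \<one>\<^bsub>dihedral n\<^esub>"
    by (rule bexI[where x = "(if a then i else (- i) mod int n, a)"])
       (use x in \<open>auto simp: dihedral_def mod_simps\<close>)
qed (use assms in \<open>auto simp: dihedral_def\<close>)

lemma card_dihedral: "card (carrier (dihedral n)) = 2 * n"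
  by (simp add: dihedral_def card_cartesian_product)

lemma dihedral_r_power:
  "n > 1 \<Longrightarrow> (1, False) [^]\<^bsub>dihedral n\<^esub> (k::nat) = (int k mod int n, False)"
  by (induction k) (auto simp: dihedral_def nat_pow_def mod_simps algebra_simps)

lemma dihedral_relations:
  assumes "n > 1"
  shows "(1, False) [^]\<^bsub>dihedral n\<^esub> n = \<one>\<^bsub>dihedral n\<^esub>"
    and "(0, True) [^]\<^bsub>dihedral n\<^esub> (2::nat) = \<one>\<^bsub>dihedral n\<^esub>"
    and "inv\<^bsub>dihedral n\<^esub> (0, True) \<otimes>\<^bsub>dihedral n\<^esub> (1, False) \<otimes>\<^bsub>dihedral n\<^esub> (0, True)
           = inv\<^bsub>dihedral n\<^esub> (1, False)"
proof -
  interpret group "dihedral n" using assms by (intro group_dihedral) auto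
  show "(1, False) [^]\<^bsub>dihedral n\<^esub> n = \<one>\<^bsub>dihedral n\<^esub>"
    using assms by (simp add: dihedral_r_power) (simp add: dihedral_def)
  show "(0, True) [^]\<^bsub>dihedral n\<^esub> (2::nat) = \<one>\<^bsub>dihedral n\<^esub>"
    by (simp add: dihedral_def nat_pow_def numeral_2_eq_2)
  have r: "inv\<^bsub>dihedral n\<^esub> (1, False) = ((- 1) mod int n, False)"
    by (rule inv_equality) (use assms in \<open>auto simp: dihedral_def mod_simps\<close>)
  have s: "inv\<^bsub>dihedral n\<^esub> (0, True) = (0, True)"
    by (rule inv_equality) (use assms in \<open>auto simp: dihedral_def\<close>)
  show "inv\<^bsub>dihedral n\<^esub> (0, True) \<otimes>\<^bsub>dihedral n\<^esub> (1, False) \<otimes>\<^bsub>dihedral n\<^esub> (0, True)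
           = inv\<^bsub>dihedral n\<^esub> (1, False)"
    unfolding r s by (simp add: dihedral_def)
qed

lemma vec2_eqI: "x $ 1 = y $ 1 \<Longrightarrow> x $ 2 = y $ 2 \<Longrightarrow> x = (y :: real^2)"
  by (simp add: vec_eq_iff forall_2)

lemma rotation_nth [simp]:
  "rotation t x $ 1 = cos t * x $ 1 - sin t * x $ 2"
  "rotation t x $ 2 = sin t * x $ 1 + cos t * x $ 2"
  by (simp_all add: rotation_def vector_2)

lemma reflection_nth [simp]: "reflection x $ 1 = x $ 1" "reflection x $ 2 = - x $ 2"
  by (simp_all add: reflection_def vector_2)

lemma rotation_rotation: "rotation s (rotation t x) = rotation (s + t) x"
  by (rule vec2_eqI) (simp_all add: cos_add sin_add algebra_simps)

lemma rotation_0: "rotation 0 x = x"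
  by (rule vec2_eqI) simp_all

lemma rotation_2pi: "rotation (2 * pi) x = x"
  by (rule vec2_eqI) simp_all

lemma rotation_reflection: "rotation t (reflection (rotation t x)) = reflection x"
proof (rule vec2_eqI)
  have *: "cos t * (cos t * a) + sin t * (sin t * a) = a" for a :: real
    by (metis (no_types, opaque_lifting) cos_squared_eq diff_add_cancel distrib_right
        mult.assoc mult_1 power2_eq_square)
  show "rotation t (reflection (rotation t x)) $ 1 = reflection x $ 1"
    using *[of "x $ 1"] by (simp add: algebra_simps)
  show "rotation t (reflection (rotation t x)) $ 2 = reflection x $ 2"
    using *[of "x $ 2"] by (simp add: algebra_simps)
qed

lemma vertex_range: "n > 0 \<Longrightarrow> vertex n j \<in> {1..n}"
  using pos_mod_bound[of "int n" "j - 1"] pos_mod_sign[of "int n" "j - 1"]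
  by (simp add: vertex_def del: pos_mod_bound)

lemma vertex_cong: "i mod int n = j mod int n \<Longrightarrow> vertex n i = vertex n j"
  unfolding vertex_def by (metis mod_diff_left_eq)

lemma vertex_mod: "n > 0 \<Longrightarrow> int (vertex n j) mod int n = j mod int n"
  by (simp add: vertex_def mod_simps)

lemma vertex_id: "k \<in> {1..n} \<Longrightarrow> vertex n (int k) = k"
  by (auto simp: vertex_def)

lemma vertex_vertex:
  assumes "n > 0"
  shows "vertex n (int (vertex n j) + c) = vertex n (j + c)"
    and "vertex n (c - int (vertex n j)) = vertex n (c - j)"
  using vertex_mod[OF assms, of j]
  by (blast intro: vertex_cong mod_add_cong mod_diff_cong)+

context
  fixes n :: nat and lab :: "'m::finite \<Rightarrow> nat"
  assumes n: "n > 0" and lab: "bij_betw lab UNIV {1..n + 1}"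
begin

lemma body_config: "k \<in> {1..n + 1} \<Longrightarrow> body lab (config lab F) k = F k"
  using lab by (simp add: body_def config_def bij_betw_def f_inv_into_f)

lemma config_eqI:
  assumes "\<And>k. k \<in> {1..n} \<Longrightarrow> body lab x k = body lab y k"
    and "body lab x (n + 1) = body lab y (n + 1)"
  shows "x = y"
proof -
  have "x $ i = y $ i" for i
  proof -
    have "lab i \<in> {1..n + 1}" using lab by (auto simp: bij_betw_def)
    then have "body lab x (lab i) = body lab y (lab i)"
      using assms by (cases "lab i = n + 1") auto
    then show ?thesis
      using lab by (simp add: body_def bij_betw_def)
  qed
  then show ?thesis by (simp add: vec_eq_iff)
qed

lemma body_act_r:
  "k \<in> {1..n} \<Longrightarrow> body lab (act_r n lab x) k = rotation (angle n) (body lab x (vertex n (int k - 1)))"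
  "body lab (act_r n lab x) (n + 1) = rotation (angle n) (body lab x (n + 1))"
  by (simp_all add: act_r_def body_config)

lemma body_act_s:
  "k \<in> {1..n} \<Longrightarrow> body lab (act_s n lab x) k = reflection (body lab x (vertex n (- int k)))"
  "body lab (act_s n lab x) (n + 1) = reflection (body lab x (n + 1))"
  using vertex_cong[of "int n - int k" n "- int k"]
  by (simp_all add: act_s_def body_config mod_simps)

lemma body_act_r_power:
  "k \<in> {1..n} \<Longrightarrow>
     body lab ((act_r n lab ^^ i) x) k = rotation (real i * angle n) (body lab x (vertex n (int k - int i)))"
  "body lab ((act_r n lab ^^ i) x) (n + 1) = rotation (real i * angle n) (body lab x (n + 1))"
proof (induction i arbitrary: k)
  case 0
  { case 1 then show ?case by (simp add: rotation_0 vertex_id) }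
  { case 2 then show ?case by (simp add: rotation_0) }
next
  case (Suc i)
  { case 1
    have "vertex n (int (vertex n (int k - 1)) - int i) = vertex n (int k - int (Suc i))"
      using vertex_vertex(1)[OF n, of "int k - 1" "- int i"] by (simp add: algebra_simps)
    then show ?case
      using 1 Suc.IH(1)[OF vertex_range[OF n]]
      by (simp add: body_act_r rotation_rotation algebra_simps) }
  { case 2 show ?case
      using Suc.IH(2) body_act_r(2) by (simp add: rotation_rotation algebra_simps) }
qed

lemma act_r_power_n: "(act_r n lab ^^ n) x = x"
proof (rule config_eqI)
  have a: "real n * angle n = 2 * pi" using n by (simp add: angle_def)
  show "body lab ((act_r n lab ^^ n) x) (n + 1) = body lab x (n + 1)"
    using body_act_r_power(2)[of n x] by (simp add: a rotation_2pi)
  fix k assume k: "k \<in> {1..n}"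
  have "vertex n (int k - int n) = k"
    using vertex_cong[of "int k - int n" n "int k"] vertex_id[OF k] by simp
  then show "body lab ((act_r n lab ^^ n) x) k = body lab x k"
    using body_act_r_power(1)[OF k, of n x] by (simp add: a rotation_2pi)
qed

lemma act_s_act_s: "act_s n lab (act_s n lab x) = x"
proof (rule config_eqI)
  have rr: "reflection (reflection y) = y" for y by (rule vec2_eqI) simp_all
  show "body lab (act_s n lab (act_s n lab x)) (n + 1) = body lab x (n + 1)"
    using body_act_s(2) by (simp add: rr)
  fix k assume k: "k \<in> {1..n}"
  have "vertex n (- int (vertex n (- int k))) = k"
    using vertex_vertex(2)[OF n, of 0 "- int k"] vertex_id[OF k] by simp
  then show "body lab (act_s n lab (act_s n lab x)) k = body lab x k"
    using k vertex_range[OF n] by (simp add: body_act_s rr)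
qed

lemma act_r_act_s_act_r: "act_r n lab (act_s n lab (act_r n lab x)) = act_s n lab x"
proof (rule config_eqI)
  show "body lab (act_r n lab (act_s n lab (act_r n lab x))) (n + 1) = body lab (act_s n lab x) (n + 1)"
    using body_act_s(2) body_act_r(2) by (simp add: rotation_reflection)
  fix k assume k: "k \<in> {1..n}"
  have "vertex n (int (vertex n (- int (vertex n (int k - 1)))) - 1) = vertex n (- int k)"
    using vertex_vertex(2)[OF n, of 0 "int k - 1"]
      vertex_vertex(1)[OF n, of "1 - int k" "- 1"] by simp
  then show "body lab (act_r n lab (act_s n lab (act_r n lab x))) k = body lab (act_s n lab x) k"
    using k vertex_range[OF n] by (simp add: body_act_s body_act_r rotation_reflection)
qed

lemma act_r_power_mod: "(act_r n lab ^^ (i mod n)) x = (act_r n lab ^^ i) x"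
  by (rule funpow_mod_eq) (rule act_r_power_n)

lemma act_s_act_r_power:
  assumes "j \<le> n"
  shows "act_s n lab ((act_r n lab ^^ j) x) = (act_r n lab ^^ (n - j)) (act_s n lab x)"
proof -
  have *: "(act_r n lab ^^ j) (act_s n lab ((act_r n lab ^^ j) x)) = act_s n lab x" for j x
  proof (induction j arbitrary: x)
    case (Suc j)
    then show ?case
      using Suc.IH[of "act_r n lab x"] act_r_act_s_act_r
      by (simp add: funpow_swap1)
  qed simp
  have "(act_r n lab ^^ (n - j)) (act_s n lab x)
      = (act_r n lab ^^ (n - j)) ((act_r n lab ^^ j) (act_s n lab ((act_r n lab ^^ j) x)))"
    by (simp only: *)
  also have "\<dots> = (act_r n lab ^^ n) (act_s n lab ((act_r n lab ^^ j) x))"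
    using assms funpow_add[of "n - j" j "act_r n lab"] by simp
  finally show ?thesis by (simp only: act_r_power_n)
qed

lemma dihedral_rep_mult:
  assumes "a \<in> carrier (dihedral n)" "b \<in> carrier (dihedral n)"
  shows "dihedral_rep n lab (a \<otimes>\<^bsub>dihedral n\<^esub> b) x = dihedral_rep n lab a (dihedral_rep n lab b x)"
proof -
  obtain i c j d where ab: "a = (int i, c)" "b = (int j, d)" "i < n" "j < n"
    using assms by (cases a; cases b)
      (auto simp: dihedral_def, metis nonneg_int_cases of_nat_less_iff)
  let ?y = "if d then act_s n lab x else x"
  show ?thesis
  proof (cases c)
    case False
    have "nat ((int i + int j) mod int n) = (i + j) mod n"
      by (simp add: nat_mod_as_int)
    then show ?thesis
      using False by (simp add: ab dihedral_rep_def dihedral_def act_r_power_mod funpow_add)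
  next
    case True
    have "(int i - int j) mod int n = (int i - int j + int n) mod int n" by simp
    also have "\<dots> = int ((i + (n - j)) mod n)"
      using ab by (simp add: of_nat_mod of_nat_diff algebra_simps)
    finally have "nat ((int i - int j) mod int n) = (i + (n - j)) mod n" by simp
    then show ?thesis
      using True act_s_act_r_power[of j ?y] ab funpow_add[of i "n - j" "act_r n lab"]
      by (auto simp: dihedral_rep_def dihedral_def act_r_power_mod act_s_act_s)
  qed
qed

lemma dihedral_rep_one: "dihedral_rep n lab \<one>\<^bsub>dihedral n\<^esub> x = x"
  by (simp add: dihedral_rep_def dihedral_def)

lemma cos_sin_vertex:
  "cos (real (vertex n j) * angle n) = cos (of_int j * angle n)"
  "sin (real (vertex n j) * angle n) = sin (of_int j * angle n)"
proof -
  obtain m where "j = int (vertex n j) + int n * m"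
    using vertex_mod[OF n, of j] by (metis mod_eqE)
  then have "of_int j = real (vertex n j) + real n * of_int m"
    by (metis of_int_add of_int_mult of_int_of_nat_eq)
  then have "of_int j * angle n = real (vertex n j) * angle n + of_int m * (2 * pi)"
    using n by (simp add: angle_def field_simps)
  then have "of_int j * angle n = real (vertex n j) * angle n + 2 * pi * of_int m"
    by (simp only: mult_ac)
  then show "cos (real (vertex n j) * angle n) = cos (of_int j * angle n)"
    "sin (real (vertex n j) * angle n) = sin (of_int j * angle n)"
    by (simp_all add: cos_add sin_add sin_int_2pin cos_int_2pin)
qed

lemma body_z0: "k \<in> {1..n} \<Longrightarrow> body lab (z0 n lab) k = qvec n k"
  "body lab (z0 n lab) (n + 1) = 0"
  by (simp_all add: z0_def on_vertices_def body_config)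

lemma act_r_z0: "act_r n lab (z0 n lab) = z0 n lab"
proof (rule config_eqI)
  show "body lab (act_r n lab (z0 n lab)) (n + 1) = body lab (z0 n lab) (n + 1)"
    using body_act_r(2) body_z0(2) by (simp add: vec2_eqI)
  fix k assume k: "k \<in> {1..n}"
  have "rotation (angle n) (qvec n (vertex n (int k - 1))) = qvec n k"
  proof (rule vec2_eqI)
    have "real k * angle n = angle n + (real k - 1) * angle n" by (simp add: algebra_simps)
    then have *: "cos (real k * angle n) = cos (angle n + (real k - 1) * angle n)"
      "sin (real k * angle n) = sin (angle n + (real k - 1) * angle n)" by simp_all
    show "rotation (angle n) (qvec n (vertex n (int k - 1))) $ 1 = qvec n k $ 1"
      by (simp add: qvec_def vector_2 cos_sin_vertex * cos_add)
    show "rotation (angle n) (qvec n (vertex n (int k - 1))) $ 2 = qvec n k $ 2"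
      by (simp add: qvec_def vector_2 cos_sin_vertex * sin_add)
  qed
  then show "body lab (act_r n lab (z0 n lab)) k = body lab (z0 n lab) k"
    using k vertex_range[OF n] by (simp add: body_act_r body_z0)
qed

lemma act_s_z0: "act_s n lab (z0 n lab) = z0 n lab"
proof (rule config_eqI)
  show "body lab (act_s n lab (z0 n lab)) (n + 1) = body lab (z0 n lab) (n + 1)"
    using body_act_s(2) body_z0(2) by (simp add: vec2_eqI)
  fix k assume k: "k \<in> {1..n}"
  have "reflection (qvec n (vertex n (- int k))) = qvec n k"
    by (rule vec2_eqI) (simp_all add: qvec_def vector_2 cos_sin_vertex)
  then show "body lab (act_s n lab (z0 n lab)) k = body lab (z0 n lab) k"
    using k vertex_range[OF n] by (simp add: body_act_s body_z0)
qed

lemma dihedral_rep_z0: "dihedral_rep n lab a (z0 n lab) = z0 n lab"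
proof -
  have "(act_r n lab ^^ i) (z0 n lab) = z0 n lab" for i
    by (induction i) (simp_all add: act_r_z0)
  then show ?thesis by (simp add: dihedral_rep_def act_s_z0)
qed

end


subsection \<open>Twice continuously differentiable functions and the Hessian\<close>

definition C2 :: "('a::euclidean_space \<Rightarrow> real) \<Rightarrow> bool" where
  "C2 f \<longleftrightarrow> (\<exists>(f' :: 'a \<Rightarrow> 'a \<Rightarrow>\<^sub>L real) (f'' :: 'a \<Rightarrow> 'a \<Rightarrow>\<^sub>L 'a \<Rightarrow>\<^sub>L real).
     (\<forall>z. (f has_derivative blinfun_apply (f' z)) (at z)) \<and>
     (\<forall>z. (f' has_derivative blinfun_apply (f'' z)) (at z)) \<and>
     continuous_on UNIV f'')"

definition second_partial :: "('a::euclidean_space \<Rightarrow> real) \<Rightarrow> 'a \<Rightarrow> 'a \<Rightarrow> 'a \<Rightarrow> real" where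
  "second_partial f z i j =
     frechet_derivative (\<lambda>y. frechet_derivative f (at y) j) (at z) i"

text \<open>The Hessian matrix acting on a vector \<open>u\<close>.\<close>

definition hessian :: "('a::euclidean_space \<Rightarrow> real) \<Rightarrow> 'a \<Rightarrow> 'a \<Rightarrow> 'a" where
  "hessian f z u = (\<Sum>i\<in>Basis. (\<Sum>j\<in>Basis. second_partial f z i j * (u \<bullet> j)) *\<^sub>R i)"


subsection \<open>Block decompositions\<close>

text \<open>Internal direct sum of a finite family of subspaces, indexed so that repetitions count.\<close>

definition is_direct_sum :: "'i set \<Rightarrow> ('i \<Rightarrow> 'a::real_vector set) \<Rightarrow> bool" where
  "is_direct_sum I U \<longleftrightarrow> finite I \<and> (\<forall>i\<in>I. subspace (U i)) \<and>
     (\<forall>x. \<exists>!u. u \<in> Pi\<^sub>E I U \<and> x = (\<Sum>i\<in>I. u i))"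

definition block_diagonal :: "('a::real_vector \<Rightarrow> 'a) \<Rightarrow> 'i set \<Rightarrow> ('i \<Rightarrow> 'a set) \<Rightarrow> bool" where
  "block_diagonal A I U \<longleftrightarrow> is_direct_sum I U \<and> (\<forall>i\<in>I. A ` U i \<subseteq> U i)"

datatype block = VBlock nat | WBlock nat

definition blocks :: "nat \<Rightarrow> block set" where
  "blocks n = VBlock ` {l. 2 * l \<le> n} \<union> WBlock ` {l. 2 * l \<le> n}"

fun block_space :: "nat \<Rightarrow> ('m::finite \<Rightarrow> nat) \<Rightarrow> block \<Rightarrow> (real^2^'m) set" where
  "block_space n lab (VBlock l) =
     (if l = 0 \<or> 2 * l = n then span {v_vec n lab l}
      else if l = 1 then span {v_vec n lab 1, v'_vec n lab 1, e_center n lab 1}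
      else span {v_vec n lab l, v'_vec n lab l})"
| "block_space n lab (WBlock l) =
     (if l = 0 \<or> 2 * l = n then span {w_vec n lab l}
      else if l = 1 then span {w'_vec n lab 1, w_vec n lab 1, e_center n lab 2}
      else span {w'_vec n lab l, w_vec n lab l})"

fun block_dim :: "nat \<Rightarrow> block \<Rightarrow> nat" where
  "block_dim n (VBlock l) = (if l = 0 \<or> 2 * l = n then 1 else if l = 1 then 3 else 2)"
| "block_dim n (WBlock l) = (if l = 0 \<or> 2 * l = n then 1 else if l = 1 then 3 else 2)"

end

theory Submission
  imports Defs
begin

text \<open>
  The Hessian at a fixed point commutes with the orthogonal symmetries \<open>R\<close> and \<open>S\<close> of \<open>f\<close>,
  so it preserves each joint eigenspace of \<open>R + R\<inverse>\<close> (eigenvalue \<open>2 cos (l\<theta>)\<close>) and \<open>S\<close>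
  (eigenvalue \<open>\<plusminus>1\<close>).  These eigenspaces are pairwise orthogonal, and each listed block is
  contained in one of them.  As the dimensions of the blocks add up to \<open>2n + 2\<close>, the blocks
  are the full eigenspaces and decompose the whole space.
\<close>

section \<open>Equivariance of the Hessian\<close>

lemma linear_inner_Basis_sum:
  fixes L :: "'a::euclidean_space \<Rightarrow> real"
  assumes "linear L"
  shows "(\<Sum>j\<in>Basis. L j * (u \<bullet> j)) = L u"
proof -
  have "L u = L (\<Sum>j\<in>Basis. (u \<bullet> j) *\<^sub>R j)" by (simp add: euclidean_representation)
  also have "\<dots> = (\<Sum>j\<in>Basis. (u \<bullet> j) *\<^sub>R L j)"
    using assms by (simp add: linear_sum linear_cmul)
  finally show ?thesis by (simp add: mult.commute)
qed

lemma linear_hessian: "linear (hessian f a)"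
  by (rule linearI)
    (simp_all add: hessian_def inner_add_left algebra_simps sum.distrib sum_distrib_left
      scaleR_sum_right)

text \<open>Partial derivatives are taken through \<open>frechet_derivative\<close>, while
  \<open>C2\<close> supplies bounded linear maps; uniqueness of derivatives identifies the two. The
  outer derivative is taken in direction \<open>i\<close>, hence \<open>i\<close> fills the first
  slot of \<open>f''\<close>.\<close>

lemma second_partial_eq:
  assumes "\<And>z. (f has_derivative blinfun_apply (f' z)) (at z)"
    and "(f' has_derivative blinfun_apply f'') (at a)"
  shows "second_partial f a i j = blinfun_apply (blinfun_apply f'' i) j"
proof -
  have "frechet_derivative f (at y) = blinfun_apply (f' y)" for y
    using frechet_derivative_at[OF assms(1)] by simp
  moreover have "((\<lambda>y. blinfun_apply (f' y) j) has_derivative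
      (\<lambda>h. blinfun_apply (blinfun_apply f'' h) j)) (at a)"
    by (rule bounded_linear.has_derivative[OF blinfun.bounded_linear_left assms(2)])
  ultimately show ?thesis
    by (simp add: second_partial_def frechet_derivative_at[symmetric])
qed

text \<open>Trades the coordinate sums for the bilinear form \<open>f''\<close>, to which the chain
  rule applies directly.\<close>

lemma hessian_inner:
  assumes "\<And>z. (f has_derivative blinfun_apply (f' z)) (at z)"
    and "(f' has_derivative blinfun_apply f'') (at a)"
  shows "hessian f a u \<bullet> w = blinfun_apply (blinfun_apply f'' w) u"
proof -
  have "linear (blinfun_apply (blinfun_apply f'' i))" for i
    by (simp add: blinfun.bounded_linear_right bounded_linear.linear)
  then have row: "(\<Sum>j\<in>Basis. blinfun_apply (blinfun_apply f'' i) j * (u \<bullet> j))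
      = blinfun_apply (blinfun_apply f'' i) u" for i
    by (rule linear_inner_Basis_sum)
  have "linear (\<lambda>i. blinfun_apply (blinfun_apply f'' i) u)"
    by (intro bounded_linear.linear bounded_linear_intros)
  then have "(\<Sum>i\<in>Basis. blinfun_apply (blinfun_apply f'' i) u * (w \<bullet> i))
      = blinfun_apply (blinfun_apply f'' w) u"
    by (rule linear_inner_Basis_sum)
  then show ?thesis
    unfolding hessian_def second_partial_eq[OF assms] inner_sum_left inner_scaleR_left row
    by (simp only: inner_commute[of _ w])
qed

text \<open>Differentiating \<open>f (g z) = f z\<close> twice at the fixed point shows that
  \<open>g\<close> preserves the bilinear form of second derivatives. Since \<open>g\<close> also
  preserves the inner product, the operator representing the form commutes with
  \<open>g\<close>.\<close>

lemma hessian_equivariant: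
  assumes "C2 f" and g: "orthogonal_transformation g"
    and inv: "\<And>z. f (g z) = f z" and fixpoint: "g a = a"
  shows "hessian f a (g u) = g (hessian f a u)"
proof -
  obtain f' f'' where f': "\<And>z. (f has_derivative blinfun_apply (f' z)) (at z)"
    and f'': "\<And>z. (f' has_derivative blinfun_apply (f'' z)) (at z)"
    using assms(1) unfolding C2_def by blast
  have lin: "bounded_linear g"
    using orthogonal_transformation_linear[OF g] linear_conv_bounded_linear[of g] by simp
  have g': "(g has_derivative g) (at z)" for z
    using lin by (rule bounded_linear_imp_has_derivative)
  \<comment> \<open>Needed at every \<open>z\<close>, not only at \<open>a\<close>, because both
    sides are differentiated once more.\<close>
  have first: "blinfun_apply (f' (g z)) (g h) = blinfun_apply (f' z) h" for z h
  proof -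
    have "((\<lambda>z. f (g z)) has_derivative (\<lambda>h. blinfun_apply (f' (g z)) (g h))) (at z)"
      by (rule has_derivative_compose[OF g' f'])
    then have "(f has_derivative (\<lambda>h. blinfun_apply (f' (g z)) (g h))) (at z)"
      by (simp add: inv)
    then show ?thesis using has_derivative_unique[OF _ f'] by metis
  qed
  have second: "blinfun_apply (blinfun_apply (f'' a) (g k)) (g h)
      = blinfun_apply (blinfun_apply (f'' a) k) h" for h k
  proof -
    have "((\<lambda>z. f' (g z)) has_derivative (\<lambda>k. blinfun_apply (f'' (g a)) (g k))) (at a)"
      by (rule has_derivative_compose[OF g' f''])
    then have "((\<lambda>z. blinfun_apply (f' (g z)) (g h)) has_derivative
        (\<lambda>k. blinfun_apply (blinfun_apply (f'' a) (g k)) (g h))) (at a)"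
      unfolding fixpoint by (rule bounded_linear.has_derivative[OF blinfun.bounded_linear_left])
    moreover have "((\<lambda>z. blinfun_apply (f' z) h) has_derivative
        (\<lambda>k. blinfun_apply (blinfun_apply (f'' a) k) h)) (at a)"
      by (rule bounded_linear.has_derivative[OF blinfun.bounded_linear_left f''])
    ultimately show ?thesis
      unfolding first using has_derivative_unique by metis
  qed
  have "hessian f a (g u) \<bullet> w = g (hessian f a u) \<bullet> w" for w
  proof -
    \<comment> \<open>Surjectivity reduces the test vectors to \<open>g w'\<close>; there both sides
      equal \<open>hessian f a u \<bullet> w'\<close>.\<close>
    obtain w' where "w = g w'"
      using orthogonal_transformation_surj[OF g] by (metis surjD)
    then show ?thesis
      using g by (simp add: hessian_inner[OF f' f''] second orthogonal_transformation_def)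
  qed
  then show ?thesis by (metis vector_eq_rdot)
qed

section \<open>Orthogonal decompositions\<close>

lemma dim_Union_orthogonal:
  fixes U :: "'i \<Rightarrow> 'a::euclidean_space set"
  assumes "finite I"
    and "\<And>i j x y. \<lbrakk>i \<in> I; j \<in> I; i \<noteq> j; x \<in> U i; y \<in> U j\<rbrakk> \<Longrightarrow> x \<bullet> y = 0"
  shows "dim (\<Union>i\<in>I. U i) = (\<Sum>i\<in>I. dim (U i))"
  using assms
proof (induction I rule: finite_induct)
  case (insert i F)
  have "dim (U i \<union> (\<Union>i\<in>F. U i)) = dim (U i) + dim (\<Union>i\<in>F. U i)"
    by (rule dim_orthogonal_sum) (use insert in auto)
  moreover have "dim (\<Union>i\<in>F. U i) = (\<Sum>i\<in>F. dim (U i))"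
    using insert.prems by (intro insert.IH) auto
  ultimately show ?case using insert.hyps by simp
qed simp

lemma span_Union_subspaces:
  assumes "finite I" "\<And>i. i \<in> I \<Longrightarrow> subspace (U i)" "x \<in> span (\<Union>i\<in>I. U i)"
  shows "\<exists>u\<in>Pi\<^sub>E I U. x = (\<Sum>i\<in>I. u i)"
  using assms(3)
proof (induction rule: span_induct_alt)
  case base
  \<comment> \<open>The restriction makes the zero family \<open>undefined\<close> outside
    \<open>I\<close>, as \<open>Pi\<^sub>E\<close> demands.\<close>
  show ?case
    by (rule bexI[of _ "\<lambda>i\<in>I. 0"]) (use assms in \<open>auto simp: subspace_0\<close>)
next
  case (step c x y)
  then obtain j u where j: "j \<in> I" "x \<in> U j" and u: "u \<in> Pi\<^sub>E I U" "y = (\<Sum>i\<in>I. u i)"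
    by blast
  \<comment> \<open>The new term is absorbed into component \<open>j\<close>, so that terms from the
    same subspace are collected.\<close>
  have "(\<Sum>i\<in>I. (u(j := c *\<^sub>R x + u j)) i) = (\<Sum>i\<in>I. (if i = j then c *\<^sub>R x else 0) + u i)"
    by (rule sum.cong) auto
  also have "\<dots> = c *\<^sub>R x + y"
    using j assms(1) by (simp add: sum.distrib u)
  finally have "c *\<^sub>R x + y = (\<Sum>i\<in>I. (u(j := c *\<^sub>R x + u j)) i)" ..
  moreover have "u(j := c *\<^sub>R x + u j) \<in> Pi\<^sub>E I U"
    using j u assms(2) by (auto simp: PiE_iff extensional_def subspace_add subspace_scale)
  ultimately show ?case by blast
qed

lemma orthogonal_sum_inner:
  assumes "finite I" "j \<in> I" "\<And>i. i \<in> I \<Longrightarrow> i \<noteq> j \<Longrightarrow> y \<bullet> u i = 0"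
  shows "y \<bullet> (\<Sum>i\<in>I. u i) = y \<bullet> u j"
proof -
  have "(\<Sum>i\<in>I. y \<bullet> u i) = y \<bullet> u j + (\<Sum>i\<in>I - {j}. y \<bullet> u i)"
    by (rule sum.remove[OF assms(1,2)])
  then show ?thesis using assms(3) by (simp add: inner_sum_right)
qed

text \<open>Orthogonality makes dimensions add up, so the sum of the subspaces is the whole space
  and decompositions exist; it also forces them to be unique.\<close>

lemma orthogonal_direct_sum:
  fixes U :: "'i \<Rightarrow> 'a::euclidean_space set"
  assumes fin: "finite I" and sub: "\<And>i. i \<in> I \<Longrightarrow> subspace (U i)"
    and orth: "\<And>i j x y. \<lbrakk>i \<in> I; j \<in> I; i \<noteq> j; x \<in> U i; y \<in> U j\<rbrakk> \<Longrightarrow> x \<bullet> y = 0"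
    and dim: "(\<Sum>i\<in>I. dim (U i)) = DIM('a)"
  shows "is_direct_sum I U"
proof -
  have "dim (\<Union>i\<in>I. U i) = DIM('a)"
    using dim_Union_orthogonal[OF fin orth] dim by simp
  then have "span (\<Union>i\<in>I. U i) = UNIV" by (simp only: dim_eq_full)
  then have ex: "\<exists>u\<in>Pi\<^sub>E I U. x = (\<Sum>i\<in>I. u i)" for x
    using span_Union_subspaces[OF fin sub] by simp
  have uniq: "u = u'" if u: "u \<in> Pi\<^sub>E I U" "u' \<in> Pi\<^sub>E I U"
    and eq: "(\<Sum>i\<in>I. u i) = (\<Sum>i\<in>I. u' i)" for u u'
  proof (rule PiE_ext[OF u])
    fix j assume j: "j \<in> I"
    have d: "u i - u' i \<in> U i" if "i \<in> I" for i
      using u that sub by (auto intro: subspace_diff)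
    \<comment> \<open>The differences sum to zero, and pairing this sum with its \<open>j\<close>-th
      term leaves the squared norm of that term.\<close>
    have "(u j - u' j) \<bullet> (\<Sum>i\<in>I. u i - u' i) = (u j - u' j) \<bullet> (u j - u' j)"
      by (rule orthogonal_sum_inner[OF fin j]) (use d j orth in blast)
    then show "u j = u' j" by (simp add: sum_subtractf eq)
  qed
  show ?thesis
    unfolding is_direct_sum_def using fin sub ex uniq by blast
qed

text \<open>If \<open>x\<close> lies in \<open>E j\<close> and has components \<open>u i\<close>,
  then \<open>x - u j\<close> lies in \<open>E j\<close> too, so it is orthogonal to every other
  component. It is therefore orthogonal to their sum, which is \<open>x - u j\<close> itself, and
  vanishes.\<close>

lemma orthogonal_direct_sum_maximal:
  assumes "is_direct_sum I U" "\<And>i. i \<in> I \<Longrightarrow> U i \<subseteq> E i" "\<And>i. i \<in> I \<Longrightarrow> subspace (E i)"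
    and orth: "\<And>i j x y. \<lbrakk>i \<in> I; j \<in> I; i \<noteq> j; x \<in> E i; y \<in> E j\<rbrakk> \<Longrightarrow> x \<bullet> y = 0"
    and j: "j \<in> I"
  shows "U j = E j"
proof
  show "E j \<subseteq> U j"
  proof
    fix x assume x: "x \<in> E j"
    have fin: "finite I" using assms(1) by (simp add: is_direct_sum_def)
    obtain u where u: "u \<in> Pi\<^sub>E I U" "x = (\<Sum>i\<in>I. u i)"
      using assms(1) unfolding is_direct_sum_def by blast
    have uE: "u i \<in> E i" if "i \<in> I" for i
      using u(1) assms(2) that by blast
    have d: "x - u j \<in> E j"
      using x uE[OF j] assms(3)[OF j] by (simp add: subspace_diff)
    have "(x - u j) \<bullet> x = (x - u j) \<bullet> u j"
      unfolding u(2) by (rule orthogonal_sum_inner[OF fin j]) (use d uE orth j u(2) in blast)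
    then have "(x - u j) \<bullet> (x - u j) = 0" by (simp add: inner_diff_right)
    then show "x \<in> U j" using u(1) j by auto
  qed
qed (use assms in blast)

lemma dim_span_orthogonal_set:
  fixes A :: "'a::euclidean_space set"
  assumes "pairwise orthogonal A" "0 \<notin> A"
  shows "dim (span A) = card A"
  using pairwise_orthogonal_independent[OF assms] by (rule dim_span_eq_card_independent)

lemma dim_span_orthogonal_vectors:
  fixes x y z :: "'a::euclidean_space"
  shows "x \<noteq> 0 \<Longrightarrow> dim (span {x}) = 1"
    and "\<lbrakk>x \<noteq> 0; y \<noteq> 0; x \<bullet> y = 0\<rbrakk> \<Longrightarrow> dim (span {x, y}) = 2"
    and "\<lbrakk>x \<noteq> 0; y \<noteq> 0; z \<noteq> 0; x \<bullet> y = 0; x \<bullet> z = 0; y \<bullet> z = 0\<rbrakk> \<Longrightarrow> dim (span {x, y, z}) = 3"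
proof -
  show "x \<noteq> 0 \<Longrightarrow> dim (span {x}) = 1"
    by (subst dim_span_orthogonal_set) auto
  show "\<lbrakk>x \<noteq> 0; y \<noteq> 0; x \<bullet> y = 0\<rbrakk> \<Longrightarrow> dim (span {x, y}) = 2"
    by (subst dim_span_orthogonal_set)
      (auto simp: pairwise_insert orthogonal_def inner_commute card_insert_if)
  show "\<lbrakk>x \<noteq> 0; y \<noteq> 0; z \<noteq> 0; x \<bullet> y = 0; x \<bullet> z = 0; y \<bullet> z = 0\<rbrakk> \<Longrightarrow> dim (span {x, y, z}) = 3"
    by (subst dim_span_orthogonal_set)
      (auto simp: pairwise_insert orthogonal_def inner_commute card_insert_if)
qed

section \<open>Joint eigenspaces of the symmetries\<close>

text \<open>For invertible \<open>R\<close> the first equation is \<open>(R + R\<inverse>) x = c x\<close>, with the inverse cleared.\<close>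

definition joint_eigenspace ::
    "('a::real_vector \<Rightarrow> 'a) \<Rightarrow> ('a \<Rightarrow> 'a) \<Rightarrow> real \<Rightarrow> real \<Rightarrow> 'a set" where
  "joint_eigenspace R S c e = {x. R (R x) + x = c *\<^sub>R R x \<and> S x = e *\<^sub>R x}"

lemma subspace_joint_eigenspace:
  assumes "linear R" "linear S"
  shows "subspace (joint_eigenspace R S c e)"
proof (rule subspaceI)
  note R = linear_add[OF assms(1)] linear_cmul[OF assms(1)] linear_0[OF assms(1)]
    and S = linear_add[OF assms(2)] linear_cmul[OF assms(2)] linear_0[OF assms(2)]
  show "0 \<in> joint_eigenspace R S c e" by (simp add: joint_eigenspace_def R S)
  fix x assume x: "x \<in> joint_eigenspace R S c e"
  {
    fix y assume y: "y \<in> joint_eigenspace R S c e"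
    have "R (R (x + y)) + (x + y) = (R (R x) + x) + (R (R y) + y)"
      by (simp add: R algebra_simps)
    also have "\<dots> = c *\<^sub>R R (x + y)"
      using x y by (simp add: joint_eigenspace_def R scaleR_add_right)
    finally show "x + y \<in> joint_eigenspace R S c e"
      using x y by (simp add: joint_eigenspace_def S scaleR_add_right)
  next
    fix a :: real
    have "R (R (a *\<^sub>R x)) + a *\<^sub>R x = a *\<^sub>R (R (R x) + x)"
      by (simp add: R scaleR_add_right)
    then show "a *\<^sub>R x \<in> joint_eigenspace R S c e"
      using x by (simp add: joint_eigenspace_def R S)
  }
qed

text \<open>The adjoint of an orthogonal \<open>R\<close> is its inverse, so
  \<open>R + R\<inverse>\<close> is self-adjoint and its eigenvectors for distinct eigenvalues are
  orthogonal. For \<open>S\<close>, comparing \<open>S x \<bullet> S y\<close> with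
  \<open>x \<bullet> y\<close> plays the same role.\<close>

lemma joint_eigenspace_orthogonal:
  assumes R: "orthogonal_transformation R" and S: "orthogonal_transformation S"
    and x: "x \<in> joint_eigenspace R S c e" and y: "y \<in> joint_eigenspace R S c' e'"
    and e: "e\<^sup>2 = 1" and ne: "c \<noteq> c' \<or> e \<noteq> e'"
  shows "x \<bullet> y = 0"
proof -
  have Rinner: "R a \<bullet> R b = a \<bullet> b" and Sinner: "S a \<bullet> S b = a \<bullet> b" for a b
    using R S by (simp_all add: orthogonal_transformation_def)
  \<comment> \<open>Pairing with \<open>R y\<close> keeps the inverse out of sight:
    \<open>R (R x) \<bullet> R y = R x \<bullet> y\<close> and
    \<open>x \<bullet> R y = R x \<bullet> R (R y)\<close>.\<close>
  have "c * (x \<bullet> y) = (R (R x) + x) \<bullet> R y"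
    using x Rinner by (simp add: joint_eigenspace_def)
  also have "\<dots> = R x \<bullet> (R (R y) + y)"
    using Rinner by (simp add: inner_add_left inner_add_right)
  also have "\<dots> = c' * (x \<bullet> y)"
    using y Rinner by (simp add: joint_eigenspace_def)
  finally have c: "c * (x \<bullet> y) = c' * (x \<bullet> y)" .
  have "x \<bullet> y = S x \<bullet> S y" by (simp add: Sinner)
  also have "\<dots> = e * e' * (x \<bullet> y)"
    using x y by (simp add: joint_eigenspace_def)
  finally have "x \<bullet> y = e * e' * (x \<bullet> y)" .
  \<comment> \<open>With \<open>e\<^sup>2 = 1\<close> this becomes
    \<open>e * (x \<bullet> y) = e' * (x \<bullet> y)\<close>.\<close>
  then have "e * (x \<bullet> y) = e * (e * e' * (x \<bullet> y))" by (rule arg_cong)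
  also have "\<dots> = e\<^sup>2 * e' * (x \<bullet> y)" by (simp only: power2_eq_square mult.assoc)
  finally show ?thesis using c ne e by auto
qed

lemma joint_eigenspace_invariant:
  assumes "linear H" "\<And>x. H (R x) = R (H x)" "\<And>x. H (S x) = S (H x)"
  shows "H ` joint_eigenspace R S c e \<subseteq> joint_eigenspace R S c e"
proof clarify
  fix x assume "x \<in> joint_eigenspace R S c e"
  then have "H (R (R x) + x) = H (c *\<^sub>R R x)" "H (S x) = H (e *\<^sub>R x)"
    by (simp_all add: joint_eigenspace_def)
  then show "H x \<in> joint_eigenspace R S c e"
    unfolding joint_eigenspace_def linear_add[OF assms(1)] linear_cmul[OF assms(1)] assms(2,3)
    by blast
qed

section \<open>The dihedral symmetries and the block vectors\<close>

text \<open>A common form of the four families of block vectors: \<open>\<phi>\<close> shifts the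
  phase of the amplitude, and \<open>h\<close> turns the direction from radial (\<open>0\<close>) to
  tangential (\<open>pi/2\<close>). Both generators act on waves by changing these two parameters
  only.\<close>

definition wave ::
    "nat \<Rightarrow> ('m::finite \<Rightarrow> nat) \<Rightarrow> nat \<Rightarrow> real \<Rightarrow> real \<Rightarrow> real^2^'m" where
  "wave n lab l \<phi> h = on_vertices n lab (\<lambda>k. cos (real (l * k) * angle n + \<phi>) *\<^sub>R
     vector [cos (real k * angle n + h), sin (real k * angle n + h)])"

lemma block_vectors_wave:
  "v_vec n lab l = wave n lab l 0 0"
  "v'_vec n lab l = wave n lab l (pi/2) (pi/2)"
  "w_vec n lab l = wave n lab l 0 (pi/2)"
  "w'_vec n lab l = wave n lab l (- pi/2) 0"
  by (simp_all add: wave_def v_vec_def v'_vec_def w_vec_def w'_vec_def qvec_def tauvec_def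
      cos_add sin_add cos_diff)

text \<open>Restores the phases \<open>pi/2\<close> and \<open>- pi/2\<close> after the reflection
  has negated them, at the cost of a sign.\<close>

lemma wave_minus:
  "wave n lab l (\<phi> + pi) h = - wave n lab l \<phi> h"
  "wave n lab l \<phi> (h + pi) = - wave n lab l \<phi> h"
  by (auto simp: wave_def on_vertices_def config_def vec_eq_iff forall_2 simp flip: add.assoc)

definition symmetry_eigenspace ::
    "nat \<Rightarrow> ('m::finite \<Rightarrow> nat) \<Rightarrow> nat \<Rightarrow> real \<Rightarrow> (real^2^'m) set" where
  "symmetry_eigenspace n lab l e
    = joint_eigenspace (act_r n lab) (act_s n lab) (2 * cos (real l * angle n)) e"

fun block_eigenspace :: "nat \<Rightarrow> ('m::finite \<Rightarrow> nat) \<Rightarrow> block \<Rightarrow> (real^2^'m) set" where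
  "block_eigenspace n lab (VBlock l) = symmetry_eigenspace n lab l 1"
| "block_eigenspace n lab (WBlock l) = symmetry_eigenspace n lab l (- 1)"

section \<open>Planar rotations and reflections\<close>

lemma rotation_inner: "rotation t x \<bullet> rotation t y = x \<bullet> y"
proof -
  have "rotation t x \<bullet> rotation t y = ((cos t)\<^sup>2 + (sin t)\<^sup>2) * (x \<bullet> y)"
    unfolding inner_vec_def sum_2 rotation_nth inner_real_def
    by (simp only: power2_eq_square algebra_simps)
  then show ?thesis by simp
qed

lemma reflection_inner: "reflection x \<bullet> reflection y = x \<bullet> y"
  by (simp add: inner_vec_def sum_2)

text \<open>Cayley-Hamilton for a rotation, whose trace is \<open>2 * cos t\<close> and whose
  determinant is 1. It governs the central body, which the generator \<open>act_r\<close> merely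
  rotates.\<close>

lemma rotation_recurrence: "rotation t (rotation t x) + x = (2 * cos t) *\<^sub>R rotation t x"
proof -
  have "x = rotation (- t) (rotation t x)"
    by (simp add: rotation_rotation rotation_0)
  moreover have "rotation t y + rotation (- t) y = (2 * cos t) *\<^sub>R y" for y
    by (rule vec2_eqI) (simp_all add: algebra_simps)
  ultimately show ?thesis by metis
qed

lemma rotation_polar:
  "rotation t (c *\<^sub>R vector [cos a, sin a]) = c *\<^sub>R vector [cos (t + a), sin (t + a)]"
  by (rule vec2_eqI) (simp_all add: vector_2 cos_add sin_add algebra_simps)

lemma reflection_polar:
  "reflection (c *\<^sub>R vector [cos a, sin a]) = c *\<^sub>R vector [cos (- a), sin (- a)]"
  by (rule vec2_eqI) (simp_all add: vector_2)

lemma rotation_zero: "rotation t 0 = 0" and reflection_zero: "reflection 0 = 0"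
  by (simp_all add: vec2_eqI)

context
  fixes n :: nat and lab :: "'m::finite \<Rightarrow> nat"
  assumes n: "n > 0" and lab: "bij_betw lab UNIV {1..n + 1}"
begin

section \<open>The generators as orthogonal maps of configurations\<close>

lemma body_linear:
  "body lab (x + y) k = body lab x k + body lab y k"
  "body lab (c *\<^sub>R x) k = c *\<^sub>R body lab x k"
  "body lab (- x) k = - body lab x k"
  by (simp_all add: body_def)

lemma inner_config:
  "(x :: real^2^'m) \<bullet> y
    = (\<Sum>k\<in>{1..n}. body lab x k \<bullet> body lab y k) + body lab x (n + 1) \<bullet> body lab y (n + 1)"
proof -
  have "x \<bullet> y = (\<Sum>i\<in>UNIV. body lab x (lab i) \<bullet> body lab y (lab i))"
    using lab by (simp add: inner_vec_def body_def bij_betw_def)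
  also have "\<dots> = (\<Sum>k\<in>{1..n + 1}. body lab x k \<bullet> body lab y k)"
    by (rule sum.reindex_bij_betw[OF lab])
  finally show ?thesis by simp
qed

lemma sum_vertex_shift: "(\<Sum>k\<in>{1..n}. F (vertex n (int k + c))) = (\<Sum>k\<in>{1..n}. F k)"
proof (rule sum.reindex_bij_witness[of _ "\<lambda>k. vertex n (int k - c)" "\<lambda>k. vertex n (int k + c)"])
  fix k assume k: "k \<in> {1..n}"
  show "vertex n (int (vertex n (int k + c)) - c) = k" "vertex n (int (vertex n (int k - c)) + c) = k"
    using vertex_vertex(1)[OF n, of "int k + c" "- c"] vertex_vertex(1)[OF n, of "int k - c" c]
      vertex_id[OF k] by simp_all
qed (use n vertex_range in auto)

lemma sum_vertex_minus: "(\<Sum>k\<in>{1..n}. F (vertex n (- int k))) = (\<Sum>k\<in>{1..n}. F k)"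
proof (rule sum.reindex_bij_witness[of _ "\<lambda>k. vertex n (- int k)" "\<lambda>k. vertex n (- int k)"])
  fix k assume k: "k \<in> {1..n}"
  show "vertex n (- int (vertex n (- int k))) = k" "vertex n (- int (vertex n (- int k))) = k"
    using vertex_vertex(2)[OF n, of 0 "- int k"] vertex_id[OF k] by simp_all
qed (use n vertex_range in auto)

text \<open>The vertices are permuted cyclically and every body is rotated, so the bodywise inner
  products are only reordered.\<close>

lemma orthogonal_act_r: "orthogonal_transformation (act_r n lab)"
proof -
  have "linear (act_r n lab)"
  proof (rule linearI; rule config_eqI[OF n lab])
  qed (simp_all add: body_act_r[OF n lab] body_act_r(2)[OF n lab, simplified] body_linear
        vec2_eqI algebra_simps)
  moreover have "act_r n lab x \<bullet> act_r n lab y = x \<bullet> y" for x y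
    using sum_vertex_shift[of "\<lambda>k. body lab x k \<bullet> body lab y k" "- 1"]
      body_act_r(2)[OF n lab]
    by (simp add: inner_config[of "act_r n lab x"] inner_config[of x] body_act_r[OF n lab] rotation_inner)
  ultimately show ?thesis by (simp add: orthogonal_transformation_def)
qed

lemma orthogonal_act_s: "orthogonal_transformation (act_s n lab)"
proof -
  have "linear (act_s n lab)"
  proof (rule linearI; rule config_eqI[OF n lab])
  qed (simp_all add: body_act_s[OF n lab] body_act_s(2)[OF n lab, simplified] body_linear
        vec2_eqI algebra_simps)
  moreover have "act_s n lab x \<bullet> act_s n lab y = x \<bullet> y" for x y
    using sum_vertex_minus[of "\<lambda>k. body lab x k \<bullet> body lab y k"]
      body_act_s(2)[OF n lab]
    by (simp add: inner_config[of "act_s n lab x"] inner_config[of x] body_act_s[OF n lab] reflection_inner)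
  ultimately show ?thesis by (simp add: orthogonal_transformation_def)
qed

section \<open>Waves under the two generators\<close>

lemma body_wave:
  "k \<in> {1..n} \<Longrightarrow> body lab (wave n lab l \<phi> h) k = cos (real (l * k) * angle n + \<phi>) *\<^sub>R
     vector [cos (real k * angle n + h), sin (real k * angle n + h)]"
  "body lab (wave n lab l \<phi> h) (n + 1) = 0"
  by (simp_all add: wave_def on_vertices_def body_config[OF n lab])

text \<open>Reducing an index changes it by a multiple of \<open>n\<close>, and since
  \<open>l\<close> is an integer the angle changes by a multiple of \<open>2 * pi\<close>.\<close>

lemma vertex_multiple: "\<exists>m::int. real (l * vertex n j) * angle n = of_int (int l * j) * angle n + of_int m * (2 * pi)"
proof -
  obtain m where "int (vertex n j) = j + int n * m"
    using vertex_mod[OF n, of j] by (metis mod_eqE)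
  then have "real (vertex n j) = of_int j + real n * of_int m"
    by (metis of_int_add of_int_mult of_int_of_nat_eq)
  then have "real (l * vertex n j) * angle n = of_int (int l * j) * angle n + of_int (int l * m) * (2 * pi)"
    using n by (simp add: angle_def field_simps)
  then show ?thesis by blast
qed

lemma cos_vertex: "cos (real (l * vertex n j) * angle n + \<phi>) = cos (of_int (int l * j) * angle n + \<phi>)"
  and sin_vertex: "sin (real (l * vertex n j) * angle n + \<phi>) = sin (of_int (int l * j) * angle n + \<phi>)"
proof -
  obtain m :: int where "real (l * vertex n j) * angle n = of_int (int l * j) * angle n + of_int m * (2 * pi)"
    using vertex_multiple by blast
  then have *: "real (l * vertex n j) * angle n + \<phi> = (of_int (int l * j) * angle n + \<phi>) + 2 * pi * of_int m"
    by (simp only: mult_ac add_ac)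
  show "cos (real (l * vertex n j) * angle n + \<phi>) = cos (of_int (int l * j) * angle n + \<phi>)"
    "sin (real (l * vertex n j) * angle n + \<phi>) = sin (of_int (int l * j) * angle n + \<phi>)"
    unfolding * cos_add[of _ "2 * pi * of_int m"] sin_add[of _ "2 * pi * of_int m"]
    by (simp_all only: sin_int_2pin cos_int_2pin)
qed

text \<open>Passing from body \<open>k\<close> to \<open>k - 1\<close> lowers the amplitude phase by
  \<open>l\<close> times \<open>angle n\<close>; it also lowers the direction by
  \<open>angle n\<close>, which the rotation restores.\<close>

lemma act_r_wave: "act_r n lab (wave n lab l \<phi> h) = wave n lab l (\<phi> - real l * angle n) h"
proof (rule config_eqI[OF n lab])
  show "body lab (act_r n lab (wave n lab l \<phi> h)) (n + 1)
      = body lab (wave n lab l (\<phi> - real l * angle n) h) (n + 1)"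
    unfolding body_act_r(2)[OF n lab] body_wave(2) by (rule rotation_zero)
  fix k assume k: "k \<in> {1..n}"
  let ?j = "vertex n (int k - 1)" and ?t = "of_int (int k - 1) * angle n + h"
  \<comment> \<open>The direction angle is the case \<open>l = 1\<close> of the periodicity lemmas,
    with phase \<open>h\<close>.\<close>
  have t: "cos (real ?j * angle n + h) = cos ?t" "sin (real ?j * angle n + h) = sin ?t"
    using cos_vertex[of 1 "int k - 1" h] sin_vertex[of 1 "int k - 1" h] by simp_all
  have shift: "angle n + ?t = real k * angle n + h" by (simp add: algebra_simps)
  have amp: "cos (real (l * ?j) * angle n + \<phi>) = cos (real (l * k) * angle n + (\<phi> - real l * angle n))"
    unfolding cos_vertex by (simp add: algebra_simps)
  show "body lab (act_r n lab (wave n lab l \<phi> h)) k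
      = body lab (wave n lab l (\<phi> - real l * angle n) h) k"
    unfolding body_act_r(1)[OF n lab k] body_wave(1)[OF vertex_range[OF n]] body_wave(1)[OF k]
      t amp rotation_polar shift ..
qed

text \<open>At body \<open>- k\<close> the direction angle is \<open>- k\<close> times
  \<open>angle n\<close> plus \<open>h\<close>, and the reflection negates it. The amplitude phase
  is negated because the cosine is even.\<close>

lemma act_s_wave: "act_s n lab (wave n lab l \<phi> h) = wave n lab l (- \<phi>) (- h)"
proof (rule config_eqI[OF n lab])
  show "body lab (act_s n lab (wave n lab l \<phi> h)) (n + 1) = body lab (wave n lab l (- \<phi>) (- h)) (n + 1)"
    unfolding body_act_s(2)[OF n lab] body_wave(2) by (rule reflection_zero)
  fix k assume k: "k \<in> {1..n}"
  let ?j = "vertex n (- int k)" and ?t = "of_int (- int k) * angle n + h"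
  have t: "cos (real ?j * angle n + h) = cos ?t" "sin (real ?j * angle n + h) = sin ?t"
    using cos_vertex[of 1 "- int k" h] sin_vertex[of 1 "- int k" h] by simp_all
  have shift: "- ?t = real k * angle n + - h" by simp
  have "cos (real (l * ?j) * angle n + \<phi>) = cos (- (real (l * k) * angle n + - \<phi>))"
    unfolding cos_vertex by (simp add: algebra_simps)
  then have amp: "cos (real (l * ?j) * angle n + \<phi>) = cos (real (l * k) * angle n + - \<phi>)"
    by (simp only: cos_minus)
  show "body lab (act_s n lab (wave n lab l \<phi> h)) k = body lab (wave n lab l (- \<phi>) (- h)) k"
    unfolding body_act_s(1)[OF n lab k] body_wave(1)[OF vertex_range[OF n]] body_wave(1)[OF k]
      t amp reflection_polar shift ..
qed

text \<open>The identity \<open>cos (a - t) + cos (a + t) = 2 * cos t * cos a\<close> for the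
  amplitudes, centred at the middle phase \<open>\<phi> - t\<close>; the directions agree.\<close>

lemma wave_recurrence:
  "wave n lab l (\<phi> - t - t) h + wave n lab l \<phi> h = (2 * cos t) *\<^sub>R wave n lab l (\<phi> - t) h"
proof -
  have c: "cos (a + (\<phi> - t - t)) + cos (a + \<phi>) = 2 * cos t * cos (a + (\<phi> - t))" for a
  proof -
    have "cos (a + (\<phi> - t) - t) + cos (a + (\<phi> - t) + t) = 2 * cos t * cos (a + (\<phi> - t))"
      unfolding cos_diff[of _ t] cos_add[of _ t] by simp
    then show ?thesis by (simp add: algebra_simps)
  qed
  show ?thesis
  proof (rule config_eqI[OF n lab])
    fix k assume k: "k \<in> {1..n}"
    show "body lab (wave n lab l (\<phi> - t - t) h + wave n lab l \<phi> h) k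
        = body lab ((2 * cos t) *\<^sub>R wave n lab l (\<phi> - t) h) k"
      unfolding body_linear body_wave(1)[OF k] scaleR_scaleR scaleR_add_left[symmetric] c ..
  qed (simp only: body_linear body_wave(2) scaleR_zero_right add_0)
qed

section \<open>Block vectors as joint eigenvectors\<close>

lemma body_e_center:
  "k \<in> {1..n} \<Longrightarrow> body lab (e_center n lab c) k = 0"
  "body lab (e_center n lab c) (n + 1) = axis c 1"
proof -
  show "body lab (e_center n lab c) (n + 1) = axis c 1"
    by (simp add: body_def e_center_def)
  assume k: "k \<in> {1..n}"
  have "inv_into UNIV lab k \<noteq> inv_into UNIV lab (n + 1)"
    using k lab inv_into_injective[of UNIV lab k "n + 1"] by (auto simp: bij_betw_def)
  then show "body lab (e_center n lab c) k = 0"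
    by (simp add: body_def e_center_def axis_def)
qed

lemma subspace_symmetry_eigenspace: "subspace (symmetry_eigenspace n lab l e)"
  unfolding symmetry_eigenspace_def
  by (intro subspace_joint_eigenspace orthogonal_transformation_linear orthogonal_act_r orthogonal_act_s)

lemma wave_eigen: "act_r n lab (act_r n lab (wave n lab l \<phi> h)) + wave n lab l \<phi> h
    = (2 * cos (real l * angle n)) *\<^sub>R act_r n lab (wave n lab l \<phi> h)"
  unfolding act_r_wave by (rule wave_recurrence)

text \<open>Every wave satisfies the equation for \<open>act_r\<close>, so only the sign under the
  reflection distinguishes the eigenspaces.\<close>

lemma wave_in_eigenspace:
  "wave n lab l (- \<phi>) (- h) = e *\<^sub>R wave n lab l \<phi> h \<Longrightarrow> wave n lab l \<phi> h \<in> symmetry_eigenspace n lab l e"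
  by (simp add: symmetry_eigenspace_def joint_eigenspace_def wave_eigen act_s_wave)

lemma block_vectors_in_eigenspace:
  "v_vec n lab l \<in> symmetry_eigenspace n lab l 1"
  "v'_vec n lab l \<in> symmetry_eigenspace n lab l 1"
  "w_vec n lab l \<in> symmetry_eigenspace n lab l (- 1)"
  "w'_vec n lab l \<in> symmetry_eigenspace n lab l (- 1)"
proof -
  show "v_vec n lab l \<in> symmetry_eigenspace n lab l 1"
    unfolding block_vectors_wave by (rule wave_in_eigenspace) simp
  show "v'_vec n lab l \<in> symmetry_eigenspace n lab l 1"
    unfolding block_vectors_wave
    \<comment> \<open>Both phases are negated here, and the two signs cancel; for
      \<open>w_vec\<close> and \<open>w'_vec\<close> below, only one phase differs from 0, which
      leaves the eigenvalue \<open>- 1\<close>.\<close>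
    using wave_minus(1)[of n lab l "- (pi/2)" "pi/2"] wave_minus(2)[of n lab l "- (pi/2)" "- (pi/2)"]
    by (intro wave_in_eigenspace) simp
  show "w_vec n lab l \<in> symmetry_eigenspace n lab l (- 1)"
    unfolding block_vectors_wave
    using wave_minus(2)[of n lab l 0 "- (pi/2)"] by (intro wave_in_eigenspace) simp
  show "w'_vec n lab l \<in> symmetry_eigenspace n lab l (- 1)"
    unfolding block_vectors_wave
    using wave_minus(1)[of n lab l "- (pi/2)" 0] by (intro wave_in_eigenspace) simp
qed

text \<open>The central body turns by \<open>angle n\<close>, which gives the eigenvalue
  \<open>2 * cos (angle n)\<close> of frequency 1; the reflection fixes the first axis and negates
  the second.\<close>

lemma e_center_in_eigenspace:
  "e_center n lab 1 \<in> symmetry_eigenspace n lab 1 1"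
  "e_center n lab 2 \<in> symmetry_eigenspace n lab 1 (- 1)"
proof -
  \<comment> \<open>The generators keep the vertices at zero, so both eigenvalue equations become
    planar ones for body \<open>n + 1\<close>.\<close>
  have r: "body lab (act_r n lab x) k = 0" and s: "body lab (act_s n lab x) k = 0"
    if "\<And>k. k \<in> {1..n} \<Longrightarrow> body lab x k = 0" "k \<in> {1..n}" for x k
    using that vertex_range[OF n]
    by (simp_all add: body_act_r(1)[OF n lab] body_act_s(1)[OF n lab] rotation_zero reflection_zero)
  note vertices = body_e_center(1) r[OF body_e_center(1)] r[OF r[OF body_e_center(1)]]
    s[OF body_e_center(1)]
  have "act_r n lab (act_r n lab (e_center n lab c)) + e_center n lab c
    = (2 * cos (angle n)) *\<^sub>R act_r n lab (e_center n lab c)" for c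
  proof (rule config_eqI[OF n lab])
    show "body lab (act_r n lab (act_r n lab (e_center n lab c)) + e_center n lab c) (n + 1)
      = body lab ((2 * cos (angle n)) *\<^sub>R act_r n lab (e_center n lab c)) (n + 1)"
      unfolding body_linear body_act_r(2)[OF n lab] by (rule rotation_recurrence)
  qed (simp only: body_linear vertices scaleR_zero_right add_0)
  moreover have "act_s n lab (e_center n lab c) = e *\<^sub>R e_center n lab c"
    if "reflection (axis c 1) = e *\<^sub>R axis c 1" for c e
  proof (rule config_eqI[OF n lab])
    show "body lab (act_s n lab (e_center n lab c)) (n + 1) = body lab (e *\<^sub>R e_center n lab c) (n + 1)"
      unfolding body_linear body_act_s(2)[OF n lab] body_e_center(2) by (rule that)
  qed (simp only: body_linear vertices scaleR_zero_right add_0)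
  ultimately have "e_center n lab c \<in> symmetry_eigenspace n lab 1 e"
    if "reflection (axis c 1) = e *\<^sub>R axis c 1" for c e
    using that by (simp add: symmetry_eigenspace_def joint_eigenspace_def)
  moreover have "reflection (axis 1 1) = 1 *\<^sub>R axis 1 1" "reflection (axis 2 1) = (- 1) *\<^sub>R axis 2 1"
    by (rule vec2_eqI; simp add: axis_def)+
  ultimately show "e_center n lab 1 \<in> symmetry_eigenspace n lab 1 1"
    "e_center n lab 2 \<in> symmetry_eigenspace n lab 1 (- 1)"
    by blast+
qed

section \<open>Orthogonality, nonvanishing and dimensions of the blocks\<close>

text \<open>The two directions at each vertex differ by \<open>h - h'\<close>, so they are
  perpendicular body by body, whatever the amplitudes.\<close>

lemma wave_orthogonal:
  assumes "cos (h - h') = 0"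
  shows "wave n lab l \<phi> h \<bullet> wave n lab l' \<phi>' h' = 0"
proof -
  have "vector [cos (a + h), sin (a + h)] \<bullet> (vector [cos (a + h'), sin (a + h')] :: real^2) = 0" for a
    using cos_diff[of "a + h" "a + h'"] assms by (simp add: inner_vec_def sum_2 vector_2)
  then show ?thesis
    unfolding inner_config body_wave(2) by (simp add: body_wave)
qed

lemma wave_e_center_orthogonal: "wave n lab l \<phi> h \<bullet> e_center n lab c = 0"
  unfolding inner_config body_wave(2) by (simp add: body_e_center)

text \<open>The direction is a unit vector, so a body at rest means a vanishing amplitude.\<close>

lemma wave_nonzero:
  assumes "k \<in> {1..n}" "cos (real (l * k) * angle n + \<phi>) \<noteq> 0"
  shows "wave n lab l \<phi> h \<noteq> 0"
proof
  assume "wave n lab l \<phi> h = 0"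
  then have "(vector [cos (real k * angle n + h), sin (real k * angle n + h)] :: real^2) = 0"
    using body_wave(1)[OF assms(1), of l \<phi> h] assms(2) by (simp add: body_def)
  then have "cos (real k * angle n + h) = 0" "sin (real k * angle n + h) = 0"
    by (simp_all only: vec_eq_iff forall_2 vector_2 zero_index)
  then show False using sin_zero_abs_cos_one by force
qed

lemma block_vectors_nonzero:
  "v_vec n lab l \<noteq> 0" "w_vec n lab l \<noteq> 0"
  "0 < l \<Longrightarrow> 2 * l < n \<Longrightarrow> v'_vec n lab l \<noteq> 0"
  "0 < l \<Longrightarrow> 2 * l < n \<Longrightarrow> w'_vec n lab l \<noteq> 0"
proof -
  \<comment> \<open>Body \<open>n\<close> is the witness: the cosine amplitude equals 1
    there.\<close>
  have "real (l * n) * angle n = 2 * pi * real l" using n by (simp add: angle_def)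
  then have "cos (real (l * n) * angle n + 0) \<noteq> 0" using cos_2npi[of l] by (simp only: mult_ac add_0_right)
  then have "wave n lab l 0 h \<noteq> 0" for h
    by (rule wave_nonzero[rotated]) (use n in auto)
  then show "v_vec n lab l \<noteq> 0" "w_vec n lab l \<noteq> 0"
    by (simp_all add: block_vectors_wave)
next
  assume l: "0 < l" "2 * l < n"
  \<comment> \<open>Body 1 is the witness: its angle lies strictly between 0 and \<open>pi\<close>.
    For \<open>l = 0\<close> and \<open>2 * l = n\<close> the sine amplitude is zero at all
    vertices, which is why those blocks are one-dimensional.\<close>
  have "sin (real l * angle n) > 0"
  proof (rule sin_gt_zero)
    have "real (2 * l) < real n" using l by (simp only: of_nat_less_iff)
    then show "real l * angle n < pi" using n by (simp add: angle_def field_simps)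
  qed (use l n in \<open>simp add: angle_def\<close>)
  then have "cos (real (l * 1) * angle n + pi/2) \<noteq> 0" "cos (real (l * 1) * angle n + - pi/2) \<noteq> 0"
    by (simp_all add: cos_add cos_diff)
  from this[THEN wave_nonzero[rotated]]
  have "wave n lab l (pi/2) h \<noteq> 0" "wave n lab l (- pi/2) h \<noteq> 0" for h
    using n by auto
  then show "v'_vec n lab l \<noteq> 0" "w'_vec n lab l \<noteq> 0"
    by (simp_all add: block_vectors_wave)
qed

lemma e_center_nonzero: "e_center n lab c \<noteq> 0"
  by (simp add: e_center_def axis_eq_0_iff)

lemma block_vectors_orthogonal:
  "v_vec n lab l \<bullet> v'_vec n lab l = 0" "w'_vec n lab l \<bullet> w_vec n lab l = 0"
  "v_vec n lab l \<bullet> e_center n lab c = 0" "v'_vec n lab l \<bullet> e_center n lab c = 0"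
  "w_vec n lab l \<bullet> e_center n lab c = 0" "w'_vec n lab l \<bullet> e_center n lab c = 0"
  by (simp_all add: block_vectors_wave wave_e_center_orthogonal wave_orthogonal)

lemma dim_block_space:
  assumes "B \<in> blocks n"
  shows "dim (block_space n lab B) = block_dim n B"
proof -
  have "dim (block_space n lab (VBlock l)) = block_dim n (VBlock l)
      \<and> dim (block_space n lab (WBlock l)) = block_dim n (WBlock l)" if "2 * l \<le> n" for l
  proof (cases "l = 0 \<or> 2 * l = n")
    case True
    then show ?thesis
      using block_vectors_nonzero(1,2)[of l] by (simp add: dim_span_orthogonal_vectors(1) del: dim_span)
  next
    case False
    then have "0 < l" "2 * l < n" using that by auto
    note nonzero = block_vectors_nonzero(1,2)[of l] block_vectors_nonzero(3,4)[OF this] e_center_nonzero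
    have "dim (span {v_vec n lab l, v'_vec n lab l}) = 2"
      "dim (span {w'_vec n lab l, w_vec n lab l}) = 2"
      "dim (span {v_vec n lab l, v'_vec n lab l, e_center n lab 1}) = 3"
      "dim (span {w'_vec n lab l, w_vec n lab l, e_center n lab 2}) = 3"
      by (intro dim_span_orthogonal_vectors nonzero block_vectors_orthogonal)+
    then show ?thesis
      using False by (cases "l = 1") (simp_all del: dim_span One_nat_def)
  qed
  then show ?thesis using assms by (auto simp: blocks_def simp del: block_space.simps block_dim.simps)
qed

section \<open>Blocks inside pairwise orthogonal eigenspaces\<close>

lemma subspace_block_eigenspace: "subspace (block_eigenspace n lab B)"
  by (cases B) (simp_all add: subspace_symmetry_eigenspace)

lemma block_space_subset_eigenspace: "block_space n lab B \<subseteq> block_eigenspace n lab B"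
proof -
  have "span A \<subseteq> symmetry_eigenspace n lab l e" if "A \<subseteq> symmetry_eigenspace n lab l e" for A l e
    using that subspace_symmetry_eigenspace by (rule span_minimal)
  then show ?thesis
    using block_vectors_in_eigenspace e_center_in_eigenspace by (cases B) simp_all
qed

text \<open>For \<open>2 * l \<le> n\<close> the angles lie in \<open>[0, pi]\<close>, where the
  cosine is injective. Hence the first eigenvalue determines \<open>l\<close>, and the second
  separates \<open>VBlock\<close> from \<open>WBlock\<close>.\<close>

lemma block_eigenspace_orthogonal:
  assumes "B \<in> blocks n" "B' \<in> blocks n" "B \<noteq> B'"
    and "x \<in> block_eigenspace n lab B" "y \<in> block_eigenspace n lab B'"
  shows "x \<bullet> y = 0"
proof -
  have range: "0 \<le> real l * angle n \<and> real l * angle n \<le> pi" if "2 * l \<le> n" for l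
  proof -
    have "real (2 * l) \<le> real n" using that by (simp only: of_nat_le_iff)
    then show ?thesis using n by (simp add: angle_def field_simps)
  qed
  have inj: "l = l'" if "2 * cos (real l * angle n) = 2 * cos (real l' * angle n)"
    "2 * l \<le> n" "2 * l' \<le> n" for l l'
  proof -
    have "real l * angle n = real l' * angle n"
      by (rule cos_inj_pi) (use that range in auto)
    then show ?thesis using n by (simp add: angle_def)
  qed
  have index: "\<exists>l e. 2 * l \<le> n \<and> block_eigenspace n lab B = symmetry_eigenspace n lab l e
      \<and> (e = 1 \<and> B = VBlock l \<or> e = - 1 \<and> B = WBlock l)" if "B \<in> blocks n" for B
  proof (cases B)
    case (VBlock l)
    with that show ?thesis
      by (intro exI[of _ l] exI[of _ 1]) (auto simp: blocks_def)
  next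
    case (WBlock l)
    with that show ?thesis
      by (intro exI[of _ l] exI[of _ "- 1"]) (auto simp: blocks_def)
  qed
  obtain l e where B: "2 * l \<le> n" "block_eigenspace n lab B = symmetry_eigenspace n lab l e"
    "e = 1 \<and> B = VBlock l \<or> e = - 1 \<and> B = WBlock l"
    using index[OF assms(1)] by (elim exE conjE)
  obtain l' e' where B': "2 * l' \<le> n" "block_eigenspace n lab B' = symmetry_eigenspace n lab l' e'"
    "e' = 1 \<and> B' = VBlock l' \<or> e' = - 1 \<and> B' = WBlock l'"
    using index[OF assms(2)] by (elim exE conjE)
  have "2 * cos (real l * angle n) \<noteq> 2 * cos (real l' * angle n) \<or> e \<noteq> e'"
    using inj[OF _ B(1) B'(1)] B(3) B'(3) assms(3) by auto
  moreover have "e\<^sup>2 = 1" using B(3) by auto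
  ultimately show ?thesis
    using assms(4,5) unfolding B(2) B'(2) symmetry_eigenspace_def
    by (intro joint_eigenspace_orthogonal[OF orthogonal_act_r orthogonal_act_s])
qed

end

section \<open>Counting dimensions and assembling the decomposition\<close>

lemma finite_blocks: "finite (blocks n)"
proof -
  have "{l. 2 * l \<le> n} \<subseteq> {..n}" by auto
  then show ?thesis by (simp add: blocks_def finite_subset)
qed

text \<open>Each of the two families contributes \<open>n + 1\<close>: two per frequency, one more
  at \<open>l = 1\<close> for the central body, one less at \<open>l = 0\<close> and, for even
  \<open>n\<close>, at \<open>l = n div 2\<close>.\<close>

lemma sum_block_dim:
  assumes "n \<ge> 3"
  shows "(\<Sum>B\<in>blocks n. block_dim n B) = 2 * (n + 1)"
proof -
  let ?d = "\<lambda>l. if l = 0 \<or> 2 * l = n then 1 else if l = 1 then 3 else 2 :: nat"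
  have set: "{l. 2 * l \<le> n} = {..n div 2}" by auto
  \<comment> \<open>The deviations from 2 become indicator terms, over the integers so that
    subtraction is exact. For \<open>n \<ge> 3\<close>, \<open>l = 1\<close> is in range and never
    satisfies \<open>2 * l = n\<close>.\<close>
  have "int (?d l) = 2 + (if l = 1 then 1 else 0) - (if l = 0 then 1 else 0)
      - (if l = n div 2 then (if even n then 1 else 0) else 0)" for l
    using assms by auto
  then have "int (\<Sum>l\<le>n div 2. ?d l) = (\<Sum>l\<le>n div 2. 2 + (if l = 1 then 1 else 0)
      - (if l = 0 then 1 else 0) - (if l = n div 2 then (if even n then 1 else 0) else 0))"
    unfolding of_nat_sum by (intro sum.cong refl)
  also have "\<dots> = 2 * (int (n div 2) + 1) - (if even n then 1 else 0)"
    using assms by (simp add: sum.distrib sum_subtractf)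
  also have "\<dots> = int n + 1" by (auto elim: oddE)
  finally have d: "(\<Sum>l\<le>n div 2. ?d l) = n + 1" by linarith
  have "(\<Sum>B\<in>blocks n. block_dim n B)
      = (\<Sum>B\<in>VBlock ` {..n div 2}. block_dim n B) + (\<Sum>B\<in>WBlock ` {..n div 2}. block_dim n B)"
    unfolding blocks_def set by (rule sum.union_disjoint) auto
  also have "\<dots> = (\<Sum>l\<le>n div 2. ?d l) + (\<Sum>l\<le>n div 2. ?d l)"
    by (simp add: sum.reindex inj_on_def)
  finally show ?thesis using d by simp
qed

theorem theorem1:
  fixes n :: nat and lab :: "'m::finite \<Rightarrow> nat" and f :: "real^2^'m \<Rightarrow> real"
  assumes "n \<ge> 3"
    and "bij_betw lab UNIV {1..n + 1}"
    and "C2 f"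
    and "\<forall>a\<in>carrier (dihedral n). \<forall>z. f (dihedral_rep n lab a z) = f z"
  shows "block_diagonal (hessian f (z0 n lab)) (blocks n) (block_space n lab) \<and>
    (\<forall>B\<in>blocks n. dim (block_space n lab B) = block_dim n B)"
proof -
  have n: "n > 0" using assms(1) by simp
  note lab = assms(2)
  let ?H = "hessian f (z0 n lab)" and ?E = "block_eigenspace n lab"
  have "(1, False) \<in> carrier (dihedral n)" "(0, True) \<in> carrier (dihedral n)"
    using assms(1) by (auto simp: dihedral_def)
  \<comment> \<open>The pairs \<open>(1, False)\<close> and \<open>(0, True)\<close> are the
    generators r and s, represented by \<open>act_r\<close> and \<open>act_s\<close>.\<close>
  then have "f (act_r n lab z) = f z" "f (act_s n lab z) = f z" for z
    using assms(4) by (force simp: dihedral_rep_def)+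
  then have H: "?H (act_r n lab u) = act_r n lab (?H u)" "?H (act_s n lab u) = act_s n lab (?H u)" for u
    using assms(3) by (auto intro!: hessian_equivariant orthogonal_act_r[OF n lab]
        orthogonal_act_s[OF n lab] act_r_z0[OF n lab] act_s_z0[OF n lab])
  have HE: "?H ` ?E B \<subseteq> ?E B" for B
    by (cases B)
      (simp_all add: symmetry_eigenspace_def joint_eigenspace_invariant linear_hessian H)
  have card: "CARD('m) = n + 1"
    using bij_betw_same_card[OF lab] by simp
  \<comment> \<open>Orthogonality is inherited from the eigenspaces containing the blocks, and the
    dimensions fill \<open>real^2^'m\<close>.\<close>
  have sum: "is_direct_sum (blocks n) (block_space n lab)"
  proof (rule orthogonal_direct_sum)
    show "subspace (block_space n lab B)" for B by (cases B) simp_all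
    show "x \<bullet> y = 0" if "B \<in> blocks n" "B' \<in> blocks n" "B \<noteq> B'"
      "x \<in> block_space n lab B" "y \<in> block_space n lab B'" for B B' x y
      using block_eigenspace_orthogonal[OF n lab that(1-3)] that(4,5)
        block_space_subset_eigenspace[OF n lab] by blast
    show "(\<Sum>B\<in>blocks n. dim (block_space n lab B)) = DIM(real^2^'m)"
      using sum_block_dim[OF assms(1)] by (simp add: dim_block_space[OF n lab] card)
  qed (rule finite_blocks)
  \<comment> \<open>Commutation gives invariance of the eigenspaces only; equality with the blocks
    transfers it.\<close>
  have "block_space n lab B = ?E B" if "B \<in> blocks n" for B
    using sum block_space_subset_eigenspace[OF n lab] subspace_block_eigenspace[OF n lab]
      block_eigenspace_orthogonal[OF n lab] that
    by (rule orthogonal_direct_sum_maximal)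
  then show ?thesis
    using HE sum dim_block_space[OF n lab] by (simp add: block_diagonal_def)
qed

end
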